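(* Suppose that $(\tilde C_n)$ is a sequence of classifiers satisfying $\tilde R(\tilde C_n)\to\tilde R(\tilde C^{\mathrm{Bayes}})$ as $n\to\infty$, and assume that \[ P_X\bigl(\{x\in\mathcal{S}^c:\tilde C^{\mathrm{Bayes}}(x)\neq C^{\mathrm{Bayes}}(x)\}\bigr)=0, \] where $\mathcal{S}=\{x\in\mathcal{X}:\eta(x)=1/2\}$. Let $\tilde{\mathcal{S}}=\{x\in\mathcal{X}:\tilde\eta(x)=1/2\}$. Then \[ \limsup_{n\to\infty}R(\tilde C_n)-R(C^{\mathrm{Bayes}})\le P_X(\tilde{\mathcal{S}}\setminus\mathcal{S}). \] In particular, if $P_X(\tilde{\mathcal{S}}\setminus\mathcal{S})=0$, then $R(\tilde C_n)\to R(C^{\mathrm{Bayes}})$ as $n\to\infty$.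
   Context: $\mathcal{X}$ is a measurable space and $(X,Y,\tilde Y)$ is a random triple in $\mathcal{X}\times\{0,1\}\times\{0,1\}$, where $X$ is a feature vector, $Y$ the true label and $\tilde Y$ a noisy label; $\mathbb{P}(Y=1)\in(0,1)$. $P_X$ is the distribution of $X$. The regression function is $\eta(x)=\mathbb{P}(Y=1\mid X=x)$. The measurable functions $\rho_0,\rho_1:\mathcal{X}\to[0,1]$ are given by $\rho_r(x)=\mathbb{P}(\tilde Y\neq Y\mid X=x,Y=r)$. The corrupted regression function is $\tilde\eta(x)=\mathbb{P}(\tilde Y=1\mid X=x)=\eta(x)\{1-\rho_1(x)\}+\{1-\eta(x)\}\rho_0(x)$. $C^{\mathrm{Bayes}}(x)=1$ if $\eta(x)\ge1/2$ and $0$ otherwise; $\tilde C^{\mathrm{Bayes}}(x)=1$ if $\tilde\eta(x)\ge1/2$ and $0$ otherwise. A classifier $C$ is a measurable function from $\mathcal{X}$ to $\{0,1\}$; it may also depend (jointly measurably) on training data independent of $(X,Y,\tilde Y)$, in which case probabilities below are also over the training data. Its risk is $R(C)=\mathbb{P}\{C(X)\neq Y\}$ and its corrupted risk is $\tilde R(C)=\mathbb{P}\{C(X)\neq\tilde Y\}$. *)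

theory Defs
  imports "HOL-Probability.Probability"
begin

text \<open>
  \<open>is_cond_prob M A N Z g\<close>: the function \<open>g\<close> is a version, with values in the unit interval, of
  \<open>z \<mapsto> P(A | Z = z)\<close>. The measure \<open>vimage_algebra (space M) Z N\<close> carries the sigma-algebra
  generated by \<open>Z\<close>.
\<close>

definition is_cond_prob ::
    "'a measure \<Rightarrow> 'a set \<Rightarrow> 'z measure \<Rightarrow> ('a \<Rightarrow> 'z) \<Rightarrow> ('z \<Rightarrow> real) \<Rightarrow> bool" where
  "is_cond_prob M A N Z g \<longleftrightarrow>
     g \<in> borel_measurable N \<and> (\<forall>z\<in>space N. 0 \<le> g z \<and> g z \<le> 1) \<and>
     (AE \<omega> in M. real_cond_exp M (vimage_algebra (space M) Z N) (indicator A) \<omega> = g (Z \<omega>))"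

abbreviation labels :: "nat measure" where
  "labels \<equiv> count_space {0, 1}"

text \<open>
  The flipping probabilities \<open>\<rho> 0\<close> and \<open>\<rho> 1\<close> are introduced jointly, as a version of
  \<open>(x, r) \<mapsto> P(Yt \<noteq> Y | X = x, Y = r)\<close>.
\<close>

locale noisy_labels = prob_space M
  for M :: "'a measure" and MX :: "'x measure" and X :: "'a \<Rightarrow> 'x"
    and Y Yt :: "'a \<Rightarrow> nat" and \<eta> :: "'x \<Rightarrow> real" and \<rho> :: "nat \<Rightarrow> 'x \<Rightarrow> real" +
  assumes X_measurable: "X \<in> M \<rightarrow>\<^sub>M MX"
    and Y_measurable: "Y \<in> M \<rightarrow>\<^sub>M labels"
    and Yt_measurable: "Yt \<in> M \<rightarrow>\<^sub>M labels"
    and prob_Y_pos: "0 < measure M {\<omega> \<in> space M. Y \<omega> = 1}"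
    and prob_Y_less_1: "measure M {\<omega> \<in> space M. Y \<omega> = 1} < 1"
    and eta_cond_prob: "is_cond_prob M {\<omega> \<in> space M. Y \<omega> = 1} MX X \<eta>"
    and rho_cond_prob: "is_cond_prob M {\<omega> \<in> space M. Yt \<omega> \<noteq> Y \<omega>} (MX \<Otimes>\<^sub>M labels)
                          (\<lambda>\<omega>. (X \<omega>, Y \<omega>)) (\<lambda>(x, r). \<rho> r x)"

definition bayes_classifier :: "('x \<Rightarrow> real) \<Rightarrow> 'x \<Rightarrow> nat" where
  "bayes_classifier \<eta> x = (if \<eta> x \<ge> 1/2 then 1 else 0)"

text \<open>
  \<open>D\<close> is the training data, independent of \<open>(X, Y, Yt)\<close>, with values in \<open>T\<close>, and \<open>C d\<close> is the
  classifier obtained from the training data \<open>d\<close>. Classifiers that do not use training data are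
  those with constant \<open>D\<close>.
\<close>

definition trained_classifier ::
    "'a measure \<Rightarrow> 'x measure \<Rightarrow> ('a \<Rightarrow> 'x) \<Rightarrow> ('a \<Rightarrow> nat) \<Rightarrow> ('a \<Rightarrow> nat) \<Rightarrow>
     'd measure \<Rightarrow> ('a \<Rightarrow> 'd) \<Rightarrow> ('d \<Rightarrow> 'x \<Rightarrow> nat) \<Rightarrow> bool" where
  "trained_classifier M MX X Y Yt T D C \<longleftrightarrow>
     D \<in> M \<rightarrow>\<^sub>M T \<and>
     prob_space.indep_set M
       (sets (vimage_algebra (space M) D T))
       (sets (vimage_algebra (space M) (\<lambda>\<omega>. (X \<omega>, Y \<omega>, Yt \<omega>)) (MX \<Otimes>\<^sub>M labels \<Otimes>\<^sub>M labels))) \<and>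
     (\<lambda>(d, x). C d x) \<in> T \<Otimes>\<^sub>M MX \<rightarrow>\<^sub>M labels"

text \<open>
  Risk with respect to the label \<open>L\<close> (true or noisy) of a possibly random classifier; \<open>C \<omega>\<close> is the
  classifier used on the outcome \<open>\<omega>\<close>.
\<close>

definition risk :: "'a measure \<Rightarrow> ('a \<Rightarrow> 'x) \<Rightarrow> ('a \<Rightarrow> nat) \<Rightarrow> ('a \<Rightarrow> 'x \<Rightarrow> nat) \<Rightarrow> real" where
  "risk M X L C = measure M {\<omega> \<in> space M. C \<omega> (X \<omega>) \<noteq> L \<omega>}"

context noisy_labels
begin

text \<open>
  The versions of \<open>P(Yt = 1 | X = x)\<close> are exactly the functions given almost everywhere by the
  usual formula in terms of \<open>\<eta>\<close> and \<open>\<rho>\<close>.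
\<close>

lemma corrupted_regression_iff:
  "is_cond_prob M {\<omega> \<in> space M. Yt \<omega> = 1} MX X g \<longleftrightarrow>
     g \<in> borel_measurable MX \<and> (\<forall>x\<in>space MX. 0 \<le> g x \<and> g x \<le> 1) \<and>
     (AE x in distr M MX X. g x = \<eta> x * (1 - \<rho> 1 x) + (1 - \<eta> x) * \<rho> 0 x)"
proof -
  have YM: "Y \<in> M \<rightarrow>\<^sub>M count_space UNIV" and YtM: "Yt \<in> M \<rightarrow>\<^sub>M count_space UNIV"
    using measurable_compose[OF Y_measurable, of "\<lambda>y. y"]
      measurable_compose[OF Yt_measurable, of "\<lambda>y. y"] by simp_all
  note [measurable] = X_measurable YM YtM
  define F where "F = vimage_algebra (space M) X MX"
  define H where "H = vimage_algebra (space M) (\<lambda>\<omega>. (X \<omega>, Y \<omega>)) (MX \<Otimes>\<^sub>M labels)"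
  have XF: "X \<in> F \<rightarrow>\<^sub>M MX"
    unfolding F_def by (rule measurable_vimage_algebra1) (use measurable_space[OF X_measurable] in auto)
  have XYM: "(\<lambda>\<omega>. (X \<omega>, Y \<omega>)) \<in> M \<rightarrow>\<^sub>M MX \<Otimes>\<^sub>M labels"
    by (rule measurable_Pair[OF X_measurable Y_measurable])
  have XYH: "(\<lambda>\<omega>. (X \<omega>, Y \<omega>)) \<in> H \<rightarrow>\<^sub>M MX \<Otimes>\<^sub>M labels"
    unfolding H_def by (rule measurable_vimage_algebra1) (use measurable_space[OF XYM] in auto)
  have XH: "X \<in> H \<rightarrow>\<^sub>M MX" using measurable_compose[OF XYH measurable_fst] by simp
  have YH: "Y \<in> H \<rightarrow>\<^sub>M labels" using measurable_compose[OF XYH measurable_snd] by simp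
  have subF: "subalgebra M F"
    unfolding subalgebra_def F_def using sets_image_in_sets[OF refl X_measurable] by simp
  have subH: "subalgebra M H"
    unfolding subalgebra_def H_def using sets_image_in_sets[OF refl XYM] by simp
  have spH: "space H = space M" and spF: "space F = space M" by (auto simp: H_def F_def)
  have subHF: "subalgebra H F"
    unfolding subalgebra_def F_def using sets_image_in_sets[OF spH XH] by (simp add: spH)
  interpret F: finite_measure_subalgebra M F by standard (rule subF)
  interpret H: finite_measure_subalgebra M H by standard (rule subH)
  let ?A = "{\<omega> \<in> space M. Yt \<omega> = 1}" and ?B = "{\<omega> \<in> space M. Y \<omega> = 1}"
    and ?N = "{\<omega> \<in> space M. Yt \<omega> \<noteq> Y \<omega>}"
  have YYt: "(\<lambda>\<omega>. (Y \<omega>, Yt \<omega>)) \<in> M \<rightarrow>\<^sub>M count_space (UNIV \<times> UNIV)"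
    using measurable_Pair[OF YM YtM] by (simp add: pair_measure_countable)
  have [measurable]: "?A \<in> sets M" "?B \<in> sets M" "?N \<in> sets M"
    using measurable_sets[OF YYt, of "UNIV \<times> {1}"] measurable_sets[OF YYt, of "{1} \<times> UNIV"]
      measurable_sets[OF YYt, of "{(y, yt). yt \<noteq> y}"]
    by (simp_all add: vimage_def Int_def conj_commute)
  have eta: "\<eta> \<in> borel_measurable MX" "\<And>x. x \<in> space MX \<Longrightarrow> 0 \<le> \<eta> x \<and> \<eta> x \<le> 1"
      "AE \<omega> in M. real_cond_exp M F (indicator ?B) \<omega> = \<eta> (X \<omega>)"
    using eta_cond_prob by (auto simp: is_cond_prob_def F_def)
  have rho': "(\<lambda>(x, r). \<rho> r x) \<in> borel_measurable (MX \<Otimes>\<^sub>M labels)"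
      "\<And>z. z \<in> space (MX \<Otimes>\<^sub>M labels) \<Longrightarrow> 0 \<le> (\<lambda>(x, r). \<rho> r x) z \<and> (\<lambda>(x, r). \<rho> r x) z \<le> 1"
      "AE \<omega> in M. real_cond_exp M H (indicator ?N) \<omega> = \<rho> (Y \<omega>) (X \<omega>)"
    using rho_cond_prob by (auto simp: is_cond_prob_def H_def)
  have rho_m: "\<rho> r \<in> borel_measurable MX" if "r \<in> {0, 1}" for r
    using measurable_compose[OF measurable_Pair2'[of r labels MX] rho'(1)] that by simp
  have rho_m0: "\<rho> 0 \<in> borel_measurable MX" and rho_m1: "\<rho> 1 \<in> borel_measurable MX"
    using rho_m by auto
  have rho_b: "0 \<le> \<rho> r x \<and> \<rho> r x \<le> 1" if "r \<in> {0, 1}" "x \<in> space MX" for r x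
    using rho'(2)[of "(x, r)"] that by (auto simp: space_pair_measure)
  note [measurable] = eta(1) rho_m0 rho_m1
  have Xs: "X \<omega> \<in> space MX" if "\<omega> \<in> space M" for \<omega> using measurable_space[OF X_measurable that] .
  have Ys: "Y \<omega> = 0 \<or> Y \<omega> = 1" if "\<omega> \<in> space M" for \<omega> using measurable_space[OF Y_measurable that] by auto
  have Yts: "Yt \<omega> = 0 \<or> Yt \<omega> = 1" if "\<omega> \<in> space M" for \<omega> using measurable_space[OF Yt_measurable that] by auto
  have int: "integrable M f" if "f \<in> borel_measurable M" "\<And>\<omega>. \<omega> \<in> space M \<Longrightarrow> \<bar>f \<omega>\<bar> \<le> c" for f :: "'a \<Rightarrow> real" and c
    by (rule integrable_const_bound[where B = c]) (use that in auto)
  have BH: "?B \<in> sets H"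
    using measurable_sets[OF YH, of "{1}"] by (simp add: spH vimage_def Int_def conj_commute)
  have AE1: "AE \<omega> in M. real_cond_exp M H (indicator ?A) \<omega> =
               indicator ?B \<omega> + (1 - 2 * indicator ?B \<omega>) * real_cond_exp M H (indicator ?N) \<omega>"
  proof -
    let ?f = "\<lambda>\<omega>. 1 - 2 * indicator ?B \<omega> :: real"
    have fH: "?f \<in> borel_measurable H" using BH by measurable
    have i1: "integrable M (\<lambda>\<omega>. ?f \<omega> * indicator ?N \<omega>)"
      by (rule int[of _ 1]) (auto simp: indicator_def)
    have i2: "integrable M (indicator ?B :: 'a \<Rightarrow> real)"
      by (rule int[of _ 1]) (auto simp: indicator_def)
    have e: "AE \<omega> in M. indicator ?A \<omega> = indicator ?B \<omega> + ?f \<omega> * indicator ?N \<omega>"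
      by (rule AE_I2) (use Ys Yts in \<open>fastforce simp: indicator_def\<close>)
    have "AE \<omega> in M. real_cond_exp M H (indicator ?A) \<omega> =
            real_cond_exp M H (\<lambda>\<omega>. indicator ?B \<omega> + ?f \<omega> * indicator ?N \<omega>) \<omega>"
      by (rule H.real_cond_exp_cong[OF e]) measurable
    moreover have "AE \<omega> in M. real_cond_exp M H (\<lambda>\<omega>. indicator ?B \<omega> + ?f \<omega> * indicator ?N \<omega>) \<omega> =
        real_cond_exp M H (indicator ?B) \<omega> + real_cond_exp M H (\<lambda>\<omega>. ?f \<omega> * indicator ?N \<omega>) \<omega>"
      by (rule H.real_cond_exp_add[OF i2 i1])
    moreover have "AE \<omega> in M. real_cond_exp M H (indicator ?B) \<omega> = indicator ?B \<omega>"
      by (rule H.real_cond_exp_F_meas[OF i2]) (use BH in measurable)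
    moreover have "AE \<omega> in M. real_cond_exp M H (\<lambda>\<omega>. ?f \<omega> * indicator ?N \<omega>) \<omega> =
        ?f \<omega> * real_cond_exp M H (indicator ?N) \<omega>"
      by (rule H.real_cond_exp_mult[OF fH _ i1]) measurable
    ultimately show ?thesis by eventually_elim simp
  qed
  let ?p = "\<lambda>\<omega>. \<rho> 0 (X \<omega>)" and ?q = "\<lambda>\<omega>. 1 - \<rho> 1 (X \<omega>) - \<rho> 0 (X \<omega>)"
  have pF: "?p \<in> borel_measurable F" and qF: "?q \<in> borel_measurable F"
    using measurable_compose[OF XF rho_m0] measurable_compose[OF XF rho_m1] by auto
  have AE2: "AE \<omega> in M. real_cond_exp M H (indicator ?A) \<omega> = ?p \<omega> + ?q \<omega> * indicator ?B \<omega>"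
    using AE1 rho'(3) AE_space
  proof eventually_elim
    case (elim \<omega>)
    show ?case using Ys[OF elim(3)] elim by (auto simp: indicator_def algebra_simps)
  qed
  have AE3: "AE \<omega> in M. real_cond_exp M F (indicator ?A) \<omega> =
               \<eta> (X \<omega>) * (1 - \<rho> 1 (X \<omega>)) + (1 - \<eta> (X \<omega>)) * \<rho> 0 (X \<omega>)"
  proof -
    have i0: "integrable M (indicator ?A :: 'a \<Rightarrow> real)"
      by (rule int[of _ 1]) (auto simp: indicator_def)
    have ip: "integrable M ?p"
      by (rule int[of _ 1]) (use rho_b Xs in auto)
    have iq: "integrable M (\<lambda>\<omega>. ?q \<omega> * indicator ?B \<omega>)"
    proof (rule int[of _ 1])
      fix \<omega> assume "\<omega> \<in> space M"
      then show "\<bar>?q \<omega> * indicator ?B \<omega>\<bar> \<le> 1"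
        using rho_b[of 0 "X \<omega>"] rho_b[of 1 "X \<omega>"] Xs by (auto simp: indicator_def)
    qed measurable
    have "AE \<omega> in M. real_cond_exp M F (real_cond_exp M H (indicator ?A)) \<omega> = real_cond_exp M F (indicator ?A) \<omega>"
      by (rule F.real_cond_exp_nested_subalg[OF subH subHF i0])
    moreover have "AE \<omega> in M. real_cond_exp M F (real_cond_exp M H (indicator ?A)) \<omega> =
        real_cond_exp M F (\<lambda>\<omega>. ?p \<omega> + ?q \<omega> * indicator ?B \<omega>) \<omega>"
      by (rule F.real_cond_exp_cong[OF AE2]) measurable
    moreover have "AE \<omega> in M. real_cond_exp M F (\<lambda>\<omega>. ?p \<omega> + ?q \<omega> * indicator ?B \<omega>) \<omega> =
        real_cond_exp M F ?p \<omega> + real_cond_exp M F (\<lambda>\<omega>. ?q \<omega> * indicator ?B \<omega>) \<omega>"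
      by (rule F.real_cond_exp_add[OF ip iq])
    moreover have "AE \<omega> in M. real_cond_exp M F ?p \<omega> = ?p \<omega>"
      by (rule F.real_cond_exp_F_meas[OF ip pF])
    moreover have "AE \<omega> in M. real_cond_exp M F (\<lambda>\<omega>. ?q \<omega> * indicator ?B \<omega>) \<omega> =
        ?q \<omega> * real_cond_exp M F (indicator ?B) \<omega>"
      by (rule F.real_cond_exp_mult[OF qF _ iq]) measurable
    ultimately show ?thesis using eta(3)
      by eventually_elim (simp add: algebra_simps)
  qed
  have "(AE \<omega> in M. real_cond_exp M F (indicator ?A) \<omega> = g (X \<omega>)) \<longleftrightarrow>
        (AE x in distr M MX X. g x = \<eta> x * (1 - \<rho> 1 x) + (1 - \<eta> x) * \<rho> 0 x)"
    if gm[measurable]: "g \<in> borel_measurable MX"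
  proof -
    have "(AE x in distr M MX X. g x = \<eta> x * (1 - \<rho> 1 x) + (1 - \<eta> x) * \<rho> 0 x) \<longleftrightarrow>
          (AE \<omega> in M. g (X \<omega>) = \<eta> (X \<omega>) * (1 - \<rho> 1 (X \<omega>)) + (1 - \<eta> (X \<omega>)) * \<rho> 0 (X \<omega>))"
      by (rule AE_distr_iff) measurable
    also have "\<dots> \<longleftrightarrow> (AE \<omega> in M. real_cond_exp M F (indicator ?A) \<omega> = g (X \<omega>))"
      by (rule eventually_subst) (use AE3 in \<open>eventually_elim, auto\<close>)
    finally show ?thesis by simp
  qed
  then show ?thesis by (auto simp: is_cond_prob_def F_def)
qed

end

end

theory Submission
  imports Defs
begin

text \<open>
  For a label \<open>L\<close> with regression function \<open>g\<close>, independence of the training data yields the excess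
  risk identity \<open>R(C) - R(Bayes) = E |2 g(X) - 1| 1{C(X) \<noteq> Bayes(X)}\<close>. Applied to the noisy label, it
  shows that the probability that \<open>C\<^sub>n\<close> disagrees with the corrupted Bayes classifier off \<open>St\<close> tends
  to 0. Applied to the true label, it bounds the excess risk of \<open>C\<^sub>n\<close> by the probability of
  disagreeing with the Bayes classifier off \<open>S\<close>. Since the two Bayes classifiers agree almost surely
  off \<open>S\<close>, only the event \<open>X \<in> St - S\<close> is not controlled.
\<close>

section \<open>Independent training data and conditional probabilities\<close>

text \<open>Independence of the generated sigma-algebras is the product formula on measurable
  rectangles, and with sigma-finite factors rectangles determine the product measure. Independence
  is phrased with \<open>vimage_algebra\<close> as in \<open>trained_classifier\<close>.\<close>

lemma (in prob_space) distr_Pair_indep_set: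
  assumes D[measurable]: "D \<in> M \<rightarrow>\<^sub>M T" and Z[measurable]: "Z \<in> M \<rightarrow>\<^sub>M N"
    and indep: "indep_set (sets (vimage_algebra (space M) D T)) (sets (vimage_algebra (space M) Z N))"
  shows "distr M (T \<Otimes>\<^sub>M N) (\<lambda>\<omega>. (D \<omega>, Z \<omega>)) = distr M T D \<Otimes>\<^sub>M distr M N Z"
proof -
  interpret PD: prob_space "distr M T D" by (rule prob_space_distr) measurable
  interpret PZ: prob_space "distr M N Z" by (rule prob_space_distr) measurable
  have "emeasure (distr M T D) A * emeasure (distr M N Z) B =
      emeasure (distr M (T \<Otimes>\<^sub>M N) (\<lambda>\<omega>. (D \<omega>, Z \<omega>))) (A \<times> B)"
    if A[measurable]: "A \<in> sets T" and B[measurable]: "B \<in> sets N" for A B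
  proof -
    have "prob ((D -` A \<inter> space M) \<inter> (Z -` B \<inter> space M)) =
        prob (D -` A \<inter> space M) * prob (Z -` B \<inter> space M)"
      by (rule indep_setD[OF indep]) (auto intro: in_vimage_algebra)
    moreover have "(\<lambda>\<omega>. (D \<omega>, Z \<omega>)) -` (A \<times> B) \<inter> space M =
        (D -` A \<inter> space M) \<inter> (Z -` B \<inter> space M)" by auto
    ultimately show ?thesis
      by (simp add: emeasure_distr emeasure_eq_measure ennreal_mult)
  qed
  then show ?thesis
    by (intro pair_measure_eqI[symmetric])
      (auto intro: PD.sigma_finite_measure_axioms PZ.sigma_finite_measure_axioms)
qed

text \<open>By independence and Fubini the training data can be frozen at a value \<open>d\<close>;
  then \<open>h (d, p (Z \<omega>))\<close> depends on the features alone, so the indicator may be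
  replaced by its conditional probability given the features. \<open>Z\<close> carries the label
  together with the features \<open>p (Z \<omega>)\<close>, since \<open>D\<close> has to be
  independent of both jointly.\<close>

lemma (in prob_space) integral_cond_prob_indep:
  fixes h :: "'d \<times> 'x \<Rightarrow> real"
  assumes D[measurable]: "D \<in> M \<rightarrow>\<^sub>M T" and Z[measurable]: "Z \<in> M \<rightarrow>\<^sub>M N"
    and indep: "indep_set (sets (vimage_algebra (space M) D T)) (sets (vimage_algebra (space M) Z N))"
    and p[measurable]: "p \<in> N \<rightarrow>\<^sub>M MX"
    and B[measurable]: "B \<in> sets N"
    and g: "is_cond_prob M {\<omega> \<in> space M. Z \<omega> \<in> B} MX (\<lambda>\<omega>. p (Z \<omega>)) g"
    and h[measurable]: "h \<in> borel_measurable (T \<Otimes>\<^sub>M MX)"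
    and bnd: "\<And>z. z \<in> space (T \<Otimes>\<^sub>M MX) \<Longrightarrow> \<bar>h z\<bar> \<le> c"
  shows "(\<integral>\<omega>. h (D \<omega>, p (Z \<omega>)) * (indicator B (Z \<omega>) - g (p (Z \<omega>))) \<partial>M) = 0"
proof -
  have gm[measurable]: "g \<in> borel_measurable MX"
    and g01: "\<And>x. x \<in> space MX \<Longrightarrow> 0 \<le> g x \<and> g x \<le> 1"
    using g by (auto simp: is_cond_prob_def)
  define X where "X = (\<lambda>\<omega>. p (Z \<omega>))"
  have X[measurable]: "X \<in> M \<rightarrow>\<^sub>M MX" unfolding X_def by measurable
  define F where "F = vimage_algebra (space M) X MX"
  have XF: "X \<in> F \<rightarrow>\<^sub>M MX"
    unfolding F_def by (rule measurable_vimage_algebra1) (use measurable_space[OF X] in auto)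
  have subF: "subalgebra M F"
    unfolding subalgebra_def F_def using sets_image_in_sets[OF refl X] by simp
  interpret F: finite_measure_subalgebra M F by standard (rule subF)
  define A where "A = {\<omega> \<in> space M. Z \<omega> \<in> B}"
  have A[measurable]: "A \<in> sets M" unfolding A_def by measurable
  have AE_g: "AE \<omega> in M. real_cond_exp M F (indicator A) \<omega> = g (X \<omega>)"
    using g by (auto simp: is_cond_prob_def F_def A_def X_def)
  interpret PD: prob_space "distr M T D" by (rule prob_space_distr) measurable
  interpret PZ: prob_space "distr M N Z" by (rule prob_space_distr) measurable
  interpret P: pair_prob_space "distr M T D" "distr M N Z" ..
  let ?f = "\<lambda>(d, z). h (d, p z) * (indicator B z - g (p z))"
  have f[measurable]: "?f \<in> borel_measurable (T \<Otimes>\<^sub>M N)" by measurable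
  have f_bnd: "norm (?f (d, z)) \<le> c" if "d \<in> space T" "z \<in> space N" for d z
  proof -
    have "p z \<in> space MX" using that by (auto intro: measurable_space[OF p])
    then have "\<bar>h (d, p z)\<bar> \<le> c" "\<bar>indicator B z - g (p z)\<bar> \<le> 1"
      using bnd[of "(d, p z)"] g01[of "p z"] that by (auto simp: space_pair_measure indicator_def)
    then have "\<bar>h (d, p z)\<bar> * \<bar>indicator B z - g (p z)\<bar> \<le> c * 1"
      by (intro mult_mono) auto
    then show ?thesis by (simp add: abs_mult)
  qed
  have f_int: "integrable (distr M T D \<Otimes>\<^sub>M distr M N Z) ?f"
    by (rule P.P.integrable_const_bound[where B = c])
      (use f_bnd in \<open>auto simp: space_pair_measure\<close>)
  have inner: "(\<integral>z. ?f (d, z) \<partial>distr M N Z) = 0" if d: "d \<in> space T" for d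
  proof -
    have hd[measurable]: "(\<lambda>x. h (d, x)) \<in> borel_measurable MX"
      using d by measurable
    have hF: "(\<lambda>\<omega>. h (d, X \<omega>)) \<in> borel_measurable F"
      by (rule measurable_compose[OF XF hd])
    have hX: "\<bar>h (d, X \<omega>)\<bar> \<le> c" if "\<omega> \<in> space M" for \<omega>
      using bnd[of "(d, X \<omega>)"] d measurable_space[OF X that] by (simp add: space_pair_measure)
    \<comment> \<open>The bound at any sample point gives this; one exists because a probability
      space is nonempty.\<close>
    have c0: "0 \<le> c" using hX not_empty by fastforce
    have i1: "integrable M (\<lambda>\<omega>. h (d, X \<omega>) * indicator A \<omega>)"
      by (rule integrable_const_bound[where B = c])
        (use hX c0 in \<open>auto simp: indicator_def\<close>)
    have gX: "\<bar>g (X \<omega>)\<bar> \<le> 1" if "\<omega> \<in> space M" for \<omega>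
      using g01[of "X \<omega>"] measurable_space[OF X that] by auto
    have i2: "integrable M (\<lambda>\<omega>. h (d, X \<omega>) * g (X \<omega>))"
    proof (rule integrable_const_bound[where B = c])
      show "AE \<omega> in M. norm (h (d, X \<omega>) * g (X \<omega>)) \<le> c"
        using mult_mono[OF hX gX c0] by (auto simp: abs_mult)
    qed measurable
    have "(\<integral>z. ?f (d, z) \<partial>distr M N Z) = (\<integral>\<omega>. ?f (d, Z \<omega>) \<partial>M)"
      using d by (intro integral_distr) measurable
    also have "\<dots> = (\<integral>\<omega>. h (d, X \<omega>) * indicator A \<omega> - h (d, X \<omega>) * g (X \<omega>) \<partial>M)"
      by (intro Bochner_Integration.integral_cong)
        (auto simp: X_def A_def indicator_def algebra_simps)
    also have "\<dots> = (\<integral>\<omega>. h (d, X \<omega>) * indicator A \<omega> \<partial>M) - (\<integral>\<omega>. h (d, X \<omega>) * g (X \<omega>) \<partial>M)"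
      by (rule Bochner_Integration.integral_diff[OF i1 i2])
    \<comment> \<open>Characteristic property of conditional expectation, tested against the
      \<open>F\<close>-measurable function \<open>h (d, X \<omega>)\<close>.\<close>
    also have "(\<integral>\<omega>. h (d, X \<omega>) * indicator A \<omega> \<partial>M) =
        (\<integral>\<omega>. h (d, X \<omega>) * real_cond_exp M F (indicator A) \<omega> \<partial>M)"
      by (rule F.real_cond_exp_intg(2)[OF i1 hF, symmetric]) measurable
    also have "\<dots> = (\<integral>\<omega>. h (d, X \<omega>) * g (X \<omega>) \<partial>M)"
      by (rule integral_cong_AE) (use AE_g in auto)
    finally show ?thesis by simp
  qed
  have "(\<integral>\<omega>. h (D \<omega>, p (Z \<omega>)) * (indicator B (Z \<omega>) - g (p (Z \<omega>))) \<partial>M) =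
      (\<integral>\<omega>. ?f (D \<omega>, Z \<omega>) \<partial>M)" by simp
  also have "\<dots> = (\<integral>w. ?f w \<partial>distr M (T \<Otimes>\<^sub>M N) (\<lambda>\<omega>. (D \<omega>, Z \<omega>)))"
    by (rule integral_distr[symmetric]) measurable
  \<comment> \<open>Independence enters here: under the product law, Fubini integrates over
    \<open>z\<close> first with \<open>d\<close> fixed, and \<open>inner\<close> applies.\<close>
  also have "\<dots> = (\<integral>w. ?f w \<partial>(distr M T D \<Otimes>\<^sub>M distr M N Z))"
    by (simp add: distr_Pair_indep_set[OF D Z indep])
  also have "\<dots> = (\<integral>d. (\<integral>z. ?f (d, z) \<partial>distr M N Z) \<partial>distr M T D)"
    by (rule P.integral_fst'[OF f_int, symmetric])
  also have "\<dots> = (\<integral>d. 0 \<partial>distr M T D)"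
    by (rule Bochner_Integration.integral_cong) (use inner in auto)
  finally show ?thesis by simp
qed

section \<open>Measurability of classifiers and of disagreement events\<close>

lemma measurable_labels_count_space:
  "f \<in> M \<rightarrow>\<^sub>M labels \<Longrightarrow> f \<in> M \<rightarrow>\<^sub>M count_space UNIV"
  by (rule measurable_compose[OF _ measurable_count_space, where g = "\<lambda>y. y"])

lemma sets_Collect_neq_countable:
  fixes f g :: "'a \<Rightarrow> 'b :: countable"
  assumes [measurable]: "f \<in> M \<rightarrow>\<^sub>M count_space UNIV" "g \<in> M \<rightarrow>\<^sub>M count_space UNIV"
  shows "{\<omega> \<in> space M. f \<omega> \<noteq> g \<omega>} \<in> sets M"
proof -
  \<comment> \<open>Splitting over the value \<open>i\<close> of \<open>f\<close> turns the event
    into a countable union.\<close>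
  have "{\<omega> \<in> space M. f \<omega> \<noteq> g \<omega>} = {\<omega> \<in> space M. \<exists>i. f \<omega> = i \<and> g \<omega> \<noteq> i}" by auto
  also have "\<dots> \<in> sets M" by measurable
  finally show ?thesis .
qed

lemma measurable_apply_classifier:
  assumes C: "(\<lambda>(d, x). C d x) \<in> T \<Otimes>\<^sub>M MX \<rightarrow>\<^sub>M labels"
    and D: "D \<in> M \<rightarrow>\<^sub>M T" and X: "X \<in> M \<rightarrow>\<^sub>M MX"
  shows "(\<lambda>\<omega>. C (D \<omega>) (X \<omega>)) \<in> M \<rightarrow>\<^sub>M count_space UNIV"
  using measurable_compose[OF measurable_Pair[OF D X] measurable_labels_count_space[OF C]] by simp

lemma bayes_classifier_measurable:
  assumes [measurable]: "g \<in> borel_measurable N"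
  shows "bayes_classifier g \<in> N \<rightarrow>\<^sub>M count_space UNIV"
  unfolding bayes_classifier_def by measurable

section \<open>Excess risk as a weighted probability of disagreement\<close>

text \<open>For values in {0, 1}, the difference of the error indicators of \<open>C\<close> and of
  the Bayes classifier \<open>b\<close> is \<open>(C - b) * (1 - 2 * L)\<close>. In the mean the
  label \<open>L\<close> may be replaced by \<open>g\<close>, and \<open>b\<close> is 1 exactly
  where \<open>g\<close> is at least 1/2, so the product becomes
  \<open>\<bar>2 * g - 1\<bar>\<close> where \<open>C\<close> and \<open>b\<close> disagree. The
  projections \<open>p\<close> and \<open>l\<close> allow one \<open>Z\<close> to serve for the true
  and for the noisy label.\<close>

lemma (in prob_space) excess_risk_eq:
  assumes D[measurable]: "D \<in> M \<rightarrow>\<^sub>M T" and Z[measurable]: "Z \<in> M \<rightarrow>\<^sub>M N"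
    and indep: "indep_set (sets (vimage_algebra (space M) D T)) (sets (vimage_algebra (space M) Z N))"
    and p[measurable]: "p \<in> N \<rightarrow>\<^sub>M MX" and l: "l \<in> N \<rightarrow>\<^sub>M labels"
    and g: "is_cond_prob M {\<omega> \<in> space M. l (Z \<omega>) = 1} MX (\<lambda>\<omega>. p (Z \<omega>)) g"
    and C: "(\<lambda>(d, x). C d x) \<in> T \<Otimes>\<^sub>M MX \<rightarrow>\<^sub>M labels"
  shows "risk M (\<lambda>\<omega>. p (Z \<omega>)) (\<lambda>\<omega>. l (Z \<omega>)) (\<lambda>\<omega>. C (D \<omega>))
           - risk M (\<lambda>\<omega>. p (Z \<omega>)) (\<lambda>\<omega>. l (Z \<omega>)) (\<lambda>_. bayes_classifier g)
         = (\<integral>\<omega>. \<bar>2 * g (p (Z \<omega>)) - 1\<bar> *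
              indicator {\<omega> \<in> space M. C (D \<omega>) (p (Z \<omega>)) \<noteq> bayes_classifier g (p (Z \<omega>))} \<omega> \<partial>M)"
proof -
  have gm[measurable]: "g \<in> borel_measurable MX"
    and g01: "\<And>x. x \<in> space MX \<Longrightarrow> 0 \<le> g x \<and> g x \<le> 1"
    using g by (auto simp: is_cond_prob_def)
  note [measurable] = measurable_labels_count_space[OF C] measurable_labels_count_space[OF l]
    bayes_classifier_measurable[OF gm]
  have Cv: "C d x = 0 \<or> C d x = 1" if "d \<in> space T" "x \<in> space MX" for d x
    using measurable_space[OF C, of "(d, x)"] that by (auto simp: space_pair_measure)
  have lv: "l z = 0 \<or> l z = 1" if "z \<in> space N" for z
    using measurable_space[OF l that] by auto
  let ?X = "\<lambda>\<omega>. p (Z \<omega>)" and ?L = "\<lambda>\<omega>. l (Z \<omega>)" and ?b = "bayes_classifier g"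
  define B where "B = {z \<in> space N. l z = 1}"
  have B[measurable]: "B \<in> sets N" unfolding B_def by measurable
  \<comment> \<open>The signed disagreement, with values -1, 0 and 1.\<close>
  define h where "h = (\<lambda>(d, x). real (C d x) - real (?b x))"
  have h[measurable]: "h \<in> borel_measurable (T \<Otimes>\<^sub>M MX)" unfolding h_def by measurable
  have hb: "\<bar>h z\<bar> \<le> 1" if "z \<in> space (T \<Otimes>\<^sub>M MX)" for z
  proof -
    have "C (fst z) (snd z) = 0 \<or> C (fst z) (snd z) = 1"
      using Cv[of "fst z" "snd z"] that by (auto simp: space_pair_measure)
    then show ?thesis by (auto simp: h_def bayes_classifier_def split_beta)
  qed
  have sp: "D \<omega> \<in> space T" "Z \<omega> \<in> space N" "?X \<omega> \<in> space MX" if "\<omega> \<in> space M" for \<omega>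
    using that by (auto intro: measurable_space[OF D] measurable_space[OF Z]
        measurable_space[OF measurable_compose[OF Z p]])
  have hX: "\<bar>h (D \<omega>, ?X \<omega>)\<bar> \<le> 1" if "\<omega> \<in> space M" for \<omega>
    using sp[OF that] hb[of "(D \<omega>, ?X \<omega>)"] by (simp add: space_pair_measure)
  have eqB: "{\<omega> \<in> space M. Z \<omega> \<in> B} = {\<omega> \<in> space M. ?L \<omega> = 1}"
    using sp(2) by (auto simp: B_def)
  let ?E = "{\<omega> \<in> space M. C (D \<omega>) (?X \<omega>) \<noteq> ?L \<omega>}" and ?G = "{\<omega> \<in> space M. ?b (?X \<omega>) \<noteq> ?L \<omega>}"
  note [measurable] = measurable_apply_classifier[OF C D measurable_compose[OF Z p]]
  have E[measurable]: "?E \<in> sets M" and G[measurable]: "?G \<in> sets M"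
    by (rule sets_Collect_neq_countable; measurable)+
  have i1: "integrable M (\<lambda>\<omega>. h (D \<omega>, ?X \<omega>) * (1 - 2 * g (?X \<omega>)))"
  proof (rule integrable_const_bound[where B = 1])
    have "\<bar>h (D \<omega>, ?X \<omega>)\<bar> * \<bar>1 - 2 * g (?X \<omega>)\<bar> \<le> 1 * 1" if "\<omega> \<in> space M" for \<omega>
      using hX[OF that] g01[OF sp(3)[OF that]] by (intro mult_mono) auto
    then show "AE \<omega> in M. norm (h (D \<omega>, ?X \<omega>) * (1 - 2 * g (?X \<omega>))) \<le> 1"
      by (auto simp: abs_mult)
  qed measurable
  have i2: "integrable M (\<lambda>\<omega>. h (D \<omega>, ?X \<omega>) * (indicator B (Z \<omega>) - g (?X \<omega>)))"
  proof (rule integrable_const_bound[where B = 1])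
    have "\<bar>h (D \<omega>, ?X \<omega>)\<bar> * \<bar>indicator B (Z \<omega>) - g (?X \<omega>)\<bar> \<le> 1 * 1" if "\<omega> \<in> space M" for \<omega>
      using hX[OF that] g01[OF sp(3)[OF that]] by (intro mult_mono) (auto simp: indicator_def)
    then show "AE \<omega> in M. norm (h (D \<omega>, ?X \<omega>) * (indicator B (Z \<omega>) - g (?X \<omega>))) \<le> 1"
      by (auto simp: abs_mult)
  qed measurable
  have "risk M ?X ?L (\<lambda>\<omega>. C (D \<omega>)) - risk M ?X ?L (\<lambda>_. ?b) =
      (\<integral>\<omega>. indicator ?E \<omega> \<partial>M) - (\<integral>\<omega>. indicator ?G \<omega> \<partial>M)"
    by (simp add: risk_def)
  also have "\<dots> = (\<integral>\<omega>. indicator ?E \<omega> - indicator ?G \<omega> \<partial>M)"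
    by (rule Bochner_Integration.integral_diff[symmetric])
      (auto intro!: integrable_real_indicator simp: emeasure_eq_measure)
  \<comment> \<open>The label is written as \<open>g\<close> plus an error; the error term
    integrates to 0 by \<open>integral_cond_prob_indep\<close>.\<close>
  also have "\<dots> = (\<integral>\<omega>. h (D \<omega>, ?X \<omega>) * (1 - 2 * g (?X \<omega>))
      - 2 * (h (D \<omega>, ?X \<omega>) * (indicator B (Z \<omega>) - g (?X \<omega>))) \<partial>M)"
  proof (rule Bochner_Integration.integral_cong[OF refl])
    fix \<omega> assume w: "\<omega> \<in> space M"
    have "indicator ?E \<omega> - indicator ?G \<omega> = h (D \<omega>, ?X \<omega>) * (1 - 2 * indicator B (Z \<omega>))"
      using w Cv[OF sp(1)[OF w] sp(3)[OF w]] lv[OF sp(2)[OF w]] sp(2)[OF w]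
      by (auto simp: h_def B_def indicator_def bayes_classifier_def)
    then show "indicator ?E \<omega> - indicator ?G \<omega> = h (D \<omega>, ?X \<omega>) * (1 - 2 * g (?X \<omega>))
      - 2 * (h (D \<omega>, ?X \<omega>) * (indicator B (Z \<omega>) - g (?X \<omega>)))"
      by (simp add: algebra_simps)
  qed
  also have "\<dots> = (\<integral>\<omega>. h (D \<omega>, ?X \<omega>) * (1 - 2 * g (?X \<omega>)) \<partial>M)
      - 2 * (\<integral>\<omega>. h (D \<omega>, ?X \<omega>) * (indicator B (Z \<omega>) - g (?X \<omega>)) \<partial>M)"
    using i1 i2 by simp
  also have "(\<integral>\<omega>. h (D \<omega>, ?X \<omega>) * (indicator B (Z \<omega>) - g (?X \<omega>)) \<partial>M) = 0"
    by (rule integral_cond_prob_indep[OF D Z indep p B _ h hb]) (use g eqB in simp_all)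
  also have "(\<integral>\<omega>. h (D \<omega>, ?X \<omega>) * (1 - 2 * g (?X \<omega>)) \<partial>M) =
      (\<integral>\<omega>. \<bar>2 * g (?X \<omega>) - 1\<bar> * indicator {\<omega> \<in> space M. C (D \<omega>) (?X \<omega>) \<noteq> ?b (?X \<omega>)} \<omega> \<partial>M)"
  \<comment> \<open>Where the classifiers disagree, \<open>h\<close> is -1 if \<open>g\<close> is at
    least 1/2 and 1 otherwise, which is the sign that makes the product nonnegative.\<close>
  proof (rule Bochner_Integration.integral_cong[OF refl])
    fix \<omega> assume w: "\<omega> \<in> space M"
    show "h (D \<omega>, ?X \<omega>) * (1 - 2 * g (?X \<omega>)) =
      \<bar>2 * g (?X \<omega>) - 1\<bar> * indicator {\<omega> \<in> space M. C (D \<omega>) (?X \<omega>) \<noteq> ?b (?X \<omega>)} \<omega>"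
      using w Cv[OF sp(1)[OF w] sp(3)[OF w]]
      by (auto simp: h_def indicator_def bayes_classifier_def)
  qed
  finally show ?thesis by simp
qed

section \<open>Removing the weight from a vanishing integral\<close>

text \<open>The weight has no positive lower bound, so points with weight in (0, 1/(k+1)) are split
  off; their measure is small for large \<open>k\<close>, uniformly in \<open>n\<close>. On the rest
  Markov's inequality applies.\<close>

lemma (in finite_measure) measure_tendsto_0_of_weighted_integral:
  fixes w :: "'a \<Rightarrow> real" and E :: "nat \<Rightarrow> 'a set"
  assumes w[measurable]: "w \<in> borel_measurable M" and w0: "\<And>\<omega>. \<omega> \<in> space M \<Longrightarrow> 0 \<le> w \<omega>"
    and wb: "\<And>\<omega>. \<omega> \<in> space M \<Longrightarrow> w \<omega> \<le> c"
    and E[measurable]: "\<And>n. E n \<in> sets M"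
    and lim: "(\<lambda>n. \<integral>\<omega>. w \<omega> * indicator (E n) \<omega> \<partial>M) \<longlonglongrightarrow> 0"
  shows "(\<lambda>n. measure M (E n \<inter> {\<omega> \<in> space M. w \<omega> \<noteq> 0})) \<longlonglongrightarrow> 0"
proof (rule LIMSEQ_I)
  fix e :: real assume e: "0 < e"
  let ?A = "\<lambda>k. {\<omega> \<in> space M. 0 < w \<omega> \<and> w \<omega> < 1 / real (Suc k)}"
  \<comment> \<open>Continuity from above; the intersection is empty by the Archimedean
    property.\<close>
  have "(\<lambda>k. measure M (?A k)) \<longlonglongrightarrow> measure M (\<Inter>k. ?A k)"
  proof (rule finite_Lim_measure_decseq)
    show "decseq ?A"
    proof (rule antimonoI)
      fix i j :: nat assume "i \<le> j"
      then have "1 / real (Suc j) \<le> 1 / real (Suc i)" by (intro divide_left_mono) auto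
      then show "?A j \<subseteq> ?A i" by auto
    qed
  qed (auto simp: image_subset_iff)
  moreover have "(\<Inter>k. ?A k) = {}"
  proof -
    have "\<exists>k. \<not> w \<omega> < 1 / real (Suc k)" if "0 < w \<omega>" for \<omega>
      using reals_Archimedean[OF that] by (auto simp: inverse_eq_divide not_less intro: less_imp_le)
    then show ?thesis by blast
  qed
  ultimately have "(\<lambda>k. measure M (?A k)) \<longlonglongrightarrow> 0" by simp
  \<comment> \<open>The level \<open>k\<close> is fixed before \<open>n\<close>, so that the Markov
    factor \<open>Suc k\<close> below is a constant.\<close>
  then obtain k where k: "measure M (?A k) < e / 2"
    using e by (auto dest!: LIMSEQ_D[of _ _ "e / 2"])
  let ?I = "\<lambda>n. \<integral>\<omega>. w \<omega> * indicator (E n) \<omega> \<partial>M"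
  have int: "integrable M (\<lambda>\<omega>. w \<omega> * indicator (E n) \<omega>)" for n
    by (rule integrable_const_bound[where B = c])
      (use w0 wb in \<open>fastforce simp: indicator_def\<close>)+
  have bound: "measure M (E n \<inter> {\<omega> \<in> space M. w \<omega> \<noteq> 0}) \<le> measure M (?A k) + real (Suc k) * ?I n" for n
  proof -
    let ?B = "{\<omega> \<in> space M. 1 / real (Suc k) \<le> w \<omega> * indicator (E n) \<omega>}"
    have "measure M (E n \<inter> {\<omega> \<in> space M. w \<omega> \<noteq> 0}) \<le> measure M (?A k \<union> ?B)"
      using w0 by (intro finite_measure_mono) (auto simp: indicator_def less_le)
    also have "\<dots> \<le> measure M (?A k) + measure M ?B"
      by (rule measure_Un_le) measurable
    also have "measure M ?B \<le> ?I n / (1 / real (Suc k))"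
      by (rule integral_Markov_inequality_measure[OF int sets.empty_sets])
        (use w0 in \<open>auto simp: indicator_def\<close>)
    finally show ?thesis by (simp add: mult.commute)
  qed
  \<comment> \<open>After multiplication by \<open>Suc k\<close> this threshold leaves the second
    half of \<open>e\<close>.\<close>
  have "0 < e / (2 * real (Suc k))" using e by simp
  from LIMSEQ_D[OF lim this] obtain N where N: "\<And>n. n \<ge> N \<Longrightarrow> \<bar>?I n\<bar> < e / (2 * real (Suc k))"
    by auto
  show "\<exists>N. \<forall>n\<ge>N. norm (measure M (E n \<inter> {\<omega> \<in> space M. w \<omega> \<noteq> 0}) - 0) < e"
  proof (intro exI allI impI)
    fix n assume "N \<le> n"
    then have "?I n < e / (2 * real (Suc k))" using N by fastforce
    then have "real (Suc k) * ?I n < e / 2"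
      by (simp add: field_simps del: of_nat_Suc)
    then show "norm (measure M (E n \<inter> {\<omega> \<in> space M. w \<omega> \<noteq> 0}) - 0) < e"
      using bound[of n] k by simp
  qed
qed

section \<open>Comparison of the true and the corrupted excess risk\<close>

theorem corollary2:
  fixes M :: "'a measure" and MX :: "'x measure" and X :: "'a \<Rightarrow> 'x"
    and Y Yt :: "'a \<Rightarrow> nat" and \<eta> \<eta>t :: "'x \<Rightarrow> real" and \<rho> :: "nat \<Rightarrow> 'x \<Rightarrow> real"
    and T :: "nat \<Rightarrow> 'd measure" and D :: "nat \<Rightarrow> 'a \<Rightarrow> 'd" and C :: "nat \<Rightarrow> 'd \<Rightarrow> 'x \<Rightarrow> nat"
    and S St :: "'x set"
  assumes "noisy_labels M MX X Y Yt \<eta> \<rho>"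
    and "is_cond_prob M {\<omega> \<in> space M. Yt \<omega> = 1} MX X \<eta>t"
    and "\<And>n. trained_classifier M MX X Y Yt (T n) (D n) (C n)"
    and "(\<lambda>n. risk M X Yt (\<lambda>\<omega>. C n (D n \<omega>))) \<longlonglongrightarrow> risk M X Yt (\<lambda>_. bayes_classifier \<eta>t)"
    and "S = {x \<in> space MX. \<eta> x = 1/2}"
    and "St = {x \<in> space MX. \<eta>t x = 1/2}"
    and "measure (distr M MX X)
           {x \<in> space MX - S. bayes_classifier \<eta>t x \<noteq> bayes_classifier \<eta> x} = 0"
  shows "limsup (\<lambda>n. ereal (risk M X Y (\<lambda>\<omega>. C n (D n \<omega>)))) - ereal (risk M X Y (\<lambda>_. bayes_classifier \<eta>))
           \<le> ereal (measure (distr M MX X) (St - S)) \<and>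
         (measure (distr M MX X) (St - S) = 0 \<longrightarrow>
           (\<lambda>n. risk M X Y (\<lambda>\<omega>. C n (D n \<omega>))) \<longlonglongrightarrow> risk M X Y (\<lambda>_. bayes_classifier \<eta>))"
proof -
  interpret noisy_labels M MX X Y Yt \<eta> \<rho> by (rule assms(1))
  note [measurable] = X_measurable
  have etam[measurable]: "\<eta> \<in> borel_measurable MX" and e01: "\<And>x. x \<in> space MX \<Longrightarrow> 0 \<le> \<eta> x \<and> \<eta> x \<le> 1"
    using eta_cond_prob by (auto simp: is_cond_prob_def)
  have etm[measurable]: "\<eta>t \<in> borel_measurable MX" and t01: "\<And>x. x \<in> space MX \<Longrightarrow> 0 \<le> \<eta>t x \<and> \<eta>t x \<le> 1"
    using assms(2) by (auto simp: is_cond_prob_def)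
  note [measurable] = bayes_classifier_measurable[OF etam] bayes_classifier_measurable[OF etm]
  have Xs: "X \<omega> \<in> space MX" if "\<omega> \<in> space M" for \<omega> using measurable_space[OF X_measurable that] .
  let ?N = "MX \<Otimes>\<^sub>M labels \<Otimes>\<^sub>M labels" and ?Z = "\<lambda>\<omega>. (X \<omega>, Y \<omega>, Yt \<omega>)"
  have Zm: "?Z \<in> M \<rightarrow>\<^sub>M ?N"
    by (intro measurable_Pair X_measurable Y_measurable Yt_measurable)
  have Dm[measurable]: "D n \<in> M \<rightarrow>\<^sub>M T n" and CL: "(\<lambda>(d, x). C n d x) \<in> T n \<Otimes>\<^sub>M MX \<rightarrow>\<^sub>M labels" for n
    using assms(3)[of n] by (auto simp: trained_classifier_def)
  have indep: "indep_set (sets (vimage_algebra (space M) (D n) (T n))) (sets (vimage_algebra (space M) ?Z ?N))" for n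
    using assms(3)[of n] by (simp add: trained_classifier_def)
  let ?b = "bayes_classifier \<eta>" and ?bt = "bayes_classifier \<eta>t"
  let ?c = "\<lambda>n \<omega>. C n (D n \<omega>) (X \<omega>)"
  let ?E = "\<lambda>n. {\<omega> \<in> space M. ?c n \<omega> \<noteq> ?b (X \<omega>)}" and ?Et = "\<lambda>n. {\<omega> \<in> space M. ?c n \<omega> \<noteq> ?bt (X \<omega>)}"
  note [measurable] = measurable_apply_classifier[OF CL Dm X_measurable]
  have [measurable]: "?E n \<in> sets M" "?Et n \<in> sets M" for n
    by (rule sets_Collect_neq_countable; measurable)+
  let ?r = "\<lambda>n. risk M X Y (\<lambda>\<omega>. C n (D n \<omega>))" and ?R = "risk M X Y (\<lambda>_. ?b)"
  \<comment> \<open>The full triple is used as \<open>Z\<close> for both labels, because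
    independence is assumed for the triple; \<open>fst\<close> extracts the features and
    \<open>l\<close> selects the label.\<close>
  have ex: "?r n - ?R = (\<integral>\<omega>. \<bar>2 * \<eta> (X \<omega>) - 1\<bar> * indicator (?E n) \<omega> \<partial>M)" for n
    using excess_risk_eq[OF Dm[of n] Zm indep[of n] measurable_fst _ _ CL[of n],
      where l = "\<lambda>z. fst (snd z)" and g = \<eta>] eta_cond_prob
    by simp
  have ext: "risk M X Yt (\<lambda>\<omega>. C n (D n \<omega>)) - risk M X Yt (\<lambda>_. ?bt) =
      (\<integral>\<omega>. \<bar>2 * \<eta>t (X \<omega>) - 1\<bar> * indicator (?Et n) \<omega> \<partial>M)" for n
    using excess_risk_eq[OF Dm[of n] Zm indep[of n] measurable_fst _ _ CL[of n],
      where l = "\<lambda>z. snd (snd z)" and g = \<eta>t] assms(2)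
    by simp
  \<comment> \<open>The weight vanishes exactly when \<open>X \<omega>\<close> lies in
    \<open>St\<close>, so \<open>a n\<close> is the probability of disagreeing with the corrupted
    Bayes classifier off \<open>St\<close>.\<close>
  define a where "a n = measure M (?Et n \<inter> {\<omega> \<in> space M. \<bar>2 * \<eta>t (X \<omega>) - 1\<bar> \<noteq> 0})" for n
  have a: "a \<longlonglongrightarrow> 0"
    unfolding a_def
  proof (rule measure_tendsto_0_of_weighted_integral[where c = 1])
    show "(\<lambda>n. \<integral>\<omega>. \<bar>2 * \<eta>t (X \<omega>) - 1\<bar> * indicator (?Et n) \<omega> \<partial>M) \<longlonglongrightarrow> 0"
      using LIM_zero[OF assms(4)] by (simp add: ext)
    show "\<bar>2 * \<eta>t (X \<omega>) - 1\<bar> \<le> 1" if "\<omega> \<in> space M" for \<omega>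
      using t01[OF Xs[OF that]] by auto
  qed auto
  let ?p = "measure (distr M MX X) (St - S)"
  have [measurable]: "S \<in> sets MX" "St \<in> sets MX" by (simp_all add: assms(5,6))
  have p: "?p = measure M {\<omega> \<in> space M. X \<omega> \<in> St - S}"
    by (subst measure_distr) (auto intro!: arg_cong[where f = "measure M"])
  let ?Q = "{\<omega> \<in> space M. X \<omega> \<notin> S \<and> ?bt (X \<omega>) \<noteq> ?b (X \<omega>)}"
  have q: "measure M ?Q = 0"
  proof -
    let ?V = "{x \<in> space MX - S. ?bt x \<noteq> ?b x}"
    \<comment> \<open>Passing from the law of \<open>X\<close> to \<open>M\<close> requires a
      measurable set, obtained by writing \<open>?V\<close> as a difference.\<close>
    have "{x \<in> space MX. ?bt x \<noteq> ?b x} \<in> sets MX"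
      by (rule sets_Collect_neq_countable; measurable)
    then have "{x \<in> space MX. ?bt x \<noteq> ?b x} - S \<in> sets MX" by simp
    also have "{x \<in> space MX. ?bt x \<noteq> ?b x} - S = ?V" by auto
    finally have "measure (distr M MX X) ?V = measure M (X -` ?V \<inter> space M)"
      by (rule measure_distr[OF X_measurable])
    also have "X -` ?V \<inter> space M = ?Q" using Xs by auto
    finally show ?thesis using assms(7) by simp
  qed
  have [measurable]: "?Q \<in> sets M"
  proof -
    have "{\<omega> \<in> space M. ?bt (X \<omega>) \<noteq> ?b (X \<omega>)} \<in> sets M"
      by (rule sets_Collect_neq_countable; measurable)
    moreover have "{\<omega> \<in> space M. X \<omega> \<notin> S} \<in> sets M" by measurable
    ultimately have "{\<omega> \<in> space M. ?bt (X \<omega>) \<noteq> ?b (X \<omega>)} \<inter> {\<omega> \<in> space M. X \<omega> \<notin> S} \<in> sets M"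
      by (rule sets.Int)
    also have "{\<omega> \<in> space M. ?bt (X \<omega>) \<noteq> ?b (X \<omega>)} \<inter> {\<omega> \<in> space M. X \<omega> \<notin> S} = ?Q" by auto
    finally show ?thesis .
  qed
  have upper: "?r n - ?R \<le> a n + ?p" for n
  proof -
    have "?r n - ?R \<le> (\<integral>\<omega>. indicator {\<omega> \<in> ?E n. X \<omega> \<notin> S} \<omega> \<partial>M)"
      unfolding ex
    proof (rule integral_mono_AE')
      show "integrable M (indicator {\<omega> \<in> ?E n. X \<omega> \<notin> S} :: 'a \<Rightarrow> real)"
        by (rule integrable_real_indicator) (auto simp: emeasure_eq_measure)
      \<comment> \<open>The weight is at most 1 and is 0 on \<open>S\<close>.\<close>
      show "AE \<omega> in M. \<bar>2 * \<eta> (X \<omega>) - 1\<bar> * indicator (?E n) \<omega> \<le> indicator {\<omega> \<in> ?E n. X \<omega> \<notin> S} \<omega>"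
      proof (rule AE_I2)
        fix \<omega> assume "\<omega> \<in> space M"
        then show "\<bar>2 * \<eta> (X \<omega>) - 1\<bar> * indicator (?E n) \<omega> \<le> indicator {\<omega> \<in> ?E n. X \<omega> \<notin> S} \<omega>"
          using e01[of "X \<omega>"] Xs[of \<omega>] by (auto simp: indicator_def assms(5))
      qed
    qed auto
    also have "\<dots> = measure M {\<omega> \<in> ?E n. X \<omega> \<notin> S}" by simp
    \<comment> \<open>Off \<open>S\<close>, a disagreement with \<open>?b\<close> either has
      \<open>?b\<close> and \<open>?bt\<close> different, which is \<open>?Q\<close>, or is a
      disagreement with \<open>?bt\<close>; the latter happens off \<open>St\<close>, as counted by
      \<open>a n\<close>, or on \<open>St - S\<close>.\<close>
    also have "\<dots> \<le> measure M ((?Et n \<inter> {\<omega> \<in> space M. \<bar>2 * \<eta>t (X \<omega>) - 1\<bar> \<noteq> 0}) \<union>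
        {\<omega> \<in> space M. X \<omega> \<in> St - S} \<union> ?Q)"
      by (intro finite_measure_mono) (auto simp: assms(6) Xs)
    also have "\<dots> \<le> a n + ?p + measure M ?Q"
      unfolding a_def p
      by (intro order_trans[OF measure_Un_le] add_right_mono) auto
    finally show ?thesis by (simp add: q)
  qed
  \<comment> \<open>Bayes optimality, read off from the nonnegative integrand; it supplies the lower
    side of the sandwich in the case \<open>?p = 0\<close>.\<close>
  have lower: "?R \<le> ?r n" for n
  proof -
    have "0 \<le> ?r n - ?R" unfolding ex by (rule integral_nonneg_AE) auto
    then show ?thesis by simp
  qed
  have lim: "(\<lambda>n. ?R + (a n + ?p)) \<longlonglongrightarrow> ?R + ?p"
    using tendsto_add[OF tendsto_const tendsto_add[OF a tendsto_const], of ?R ?p] by simp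
  \<comment> \<open>The limsup is compared with that of the upper bound, which converges;
    subtracting \<open>ereal ?R\<close> is harmless because it is finite.\<close>
  have "limsup (\<lambda>n. ereal (?r n)) \<le> limsup (\<lambda>n. ereal (?R + (a n + ?p)))"
    by (rule Limsup_mono) (use upper in \<open>auto simp: algebra_simps\<close>)
  also have "\<dots> = ereal (?R + ?p)"
    by (rule lim_imp_Limsup) (use lim in auto)
  finally have "limsup (\<lambda>n. ereal (?r n)) - ereal ?R \<le> ereal ?p"
    by (simp add: ereal_minus_le add.commute)
  moreover have "?r \<longlonglongrightarrow> ?R" if "?p = 0"
  proof (rule tendsto_sandwich[OF _ _ tendsto_const])
    show "(\<lambda>n. ?R + (a n + ?p)) \<longlonglongrightarrow> ?R" using lim that by simp
  qed (use upper lower in \<open>auto simp: algebra_simps\<close>)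
  ultimately show ?thesis by blast
qed

end
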